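(* For all integers $k,n\ge 1$, $$\mathrm{ex}(n,\overrightarrow{P_{k+1}})\le \mathrm{ex}(n,K_{k+1})+\mathrm{ex}(n,P_{k+1}).$$
   Context: Graphs are finite and simple. Digraphs are finite and strict: no loops and no parallel arcs in the same direction, but both arcs $uv$ and $vu$ may be present. $K_k$ is the complete graph on $k$ vertices, $P_k$ is the (undirected) path with $k$ vertices, and $\overrightarrow{P_k}$ is the directed path with $k$ vertices (all arcs oriented consistently along the path). A graph (digraph) is $H$-free if it contains no (not necessarily induced) subgraph (subdigraph) isomorphic to the graph (digraph) $H$. For a graph (respectively digraph) $H$, $\mathrm{ex}(n,H)$ is the maximum number of edges (respectively arcs) of an $H$-free graph (respectively digraph) on $n$ vertices. *)

theory Defs
  imports "Graph_Theory.Graph_Theory"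
begin

text \<open>
  Digraphs without parallel arcs are represented by \<open>pair_pre_digraph\<close> (arcs are ordered pairs,
  viewed as a general digraph through the coercion \<open>with_proj\<close>): \<open>pair_digraph\<close> says finite and
  loop-free, so that opposite arcs are allowed. As in \<open>Graph_Theory\<close>, a finite simple graph is a
  symmetric such digraph, \<open>pair_graph\<close>; each of its edges is thus a pair of opposite arcs.
  Vertices are natural numbers, which covers every finite graph and digraph up to isomorphism.
\<close>

definition edges :: "'a pair_pre_digraph \<Rightarrow> 'a set set" where
  "edges G = (\<lambda>(u, v). {u, v}) ` parcs G"

text \<open>
  For symmetric \<open>H\<close> a copy of \<open>H\<close> is itself symmetric, so the following is also
  the usual notion for undirected graphs.
\<close>

definition is_free :: "'b pair_pre_digraph \<Rightarrow> 'a pair_pre_digraph \<Rightarrow> bool" where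
  "is_free H G \<longleftrightarrow> \<not> (\<exists>S. subgraph S (with_proj G) \<and> digraph_iso (with_proj H) S)"

text \<open>
  The sets below are finite. They are empty, and the maximum is then unspecified, only if every
  graph (digraph) on \<open>n\<close> vertices contains \<open>H\<close>; this needs an \<open>H\<close> without arcs.
\<close>

definition ex_graph :: "nat \<Rightarrow> 'b pair_pre_digraph \<Rightarrow> nat" where
  "ex_graph n H = Max {card (edges G) | G :: nat pair_pre_digraph.
     pair_graph G \<and> card (pverts G) = n \<and> is_free H G}"

definition ex_digraph :: "nat \<Rightarrow> 'b pair_pre_digraph \<Rightarrow> nat" where
  "ex_digraph n H = Max {card (parcs G) | G :: nat pair_pre_digraph.
     pair_digraph G \<and> card (pverts G) = n \<and> is_free H G}"

definition complete_graph :: "nat \<Rightarrow> nat pair_pre_digraph" where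
  "complete_graph k = \<lparr>pverts = {..<k}, parcs = {(u, v). u < k \<and> v < k \<and> u \<noteq> v}\<rparr>"

definition path_graph :: "nat \<Rightarrow> nat pair_pre_digraph" where
  "path_graph k =
     \<lparr>pverts = {..<k}, parcs = {(u, v). u < k \<and> v < k \<and> (v = Suc u \<or> u = Suc v)}\<rparr>"

definition directed_path :: "nat \<Rightarrow> nat pair_pre_digraph" where
  "directed_path k = \<lparr>pverts = {..<k}, parcs = {(u, v). u < k \<and> v < k \<and> v = Suc u}\<rparr>"

lemma complete_digraph_complete_graph: "complete_digraph k (with_proj (complete_graph k))"
  by (auto simp: complete_digraph_pair_def complete_graph_def)

end

theory Submission
  imports Defs
begin

text \<open>
  In a digraph \<open>D\<close> without a directed path on \<open>k + 1\<close> vertices, let two vertices be adjacent in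
  \<open>G\<^sub>1\<close> if at least one arc of \<open>D\<close> joins them, and in \<open>G\<^sub>2\<close> if both opposite arcs do. Then \<open>D\<close> has
  \<open>e(G\<^sub>1) + e(G\<^sub>2)\<close> arcs. A copy of \<open>K\<^bsub>k+1\<^esub>\<close> in \<open>G\<^sub>1\<close> would carry a semicomplete subdigraph
  of \<open>D\<close>, which has a Hamiltonian directed path by Redei's theorem, and a copy of \<open>P\<^bsub>k+1\<^esub>\<close> in
  \<open>G\<^sub>2\<close> can be traversed along arcs of \<open>D\<close>; so neither exists.
\<close>

text \<open>Proved by insertion: a new vertex enters a path through the others just before the first
  one without an arc to it. Both directions may hold between two elements, so opposite arcs are
  allowed.\<close>

lemma redei_Hamiltonian_path:
  assumes "finite A" and "\<And>x y. x \<in> A \<Longrightarrow> y \<in> A \<Longrightarrow> x \<noteq> y \<Longrightarrow> R x y \<or> R y x"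
  shows "\<exists>xs. set xs = A \<and> distinct xs \<and> successively R xs"
  using assms
proof (induction A rule: finite_induct)
  case empty
  show ?case by (intro exI[of _ "[]"]) simp
next
  case (insert a A)
  then obtain xs where xs: "set xs = A" "distinct xs" "successively R xs" by auto
  let ?P = "\<lambda>x. R x a"
  define ys zs where "ys = takeWhile ?P xs" and "zs = dropWhile ?P xs"
  have split: "xs = ys @ zs" by (simp add: ys_def zs_def)
  have last: "R (last ys) a" if "ys \<noteq> []"
    using last_in_set[OF that] set_takeWhileD[of _ ?P xs] by (auto simp: ys_def)
  have hd: "R a (hd zs)" if "zs \<noteq> []"
  proof -
    \<comment> \<open>\<open>dropWhile\<close> stops at the first vertex that fails
      \<open>?P\<close>, so the arc between \<open>hd zs\<close> and \<open>a\<close> can only start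
      at \<open>a\<close>.\<close>
    have "\<not> R (hd zs) a" using that hd_dropWhile[of ?P xs] by (simp add: zs_def)
    moreover have "hd zs \<in> A" using that split xs(1) hd_in_set by fastforce
    ultimately show ?thesis using insert.prems[of a "hd zs"] insert.hyps by auto
  qed
  have "successively R (ys @ a # zs)"
    using xs(3) last hd unfolding split by (auto simp: successively_append_iff successively_Cons)
  moreover have "set (ys @ a # zs) = insert a A" using xs(1) split by auto
  moreover have "distinct (ys @ a # zs)" using xs(1,2) split insert.hyps by auto
  ultimately show ?case by blast
qed

text \<open>Arcs here are pairs of vertices, so the arc map of an isomorphism is forced by its
  vertex map. Containing a copy of \<open>H\<close> thus reduces to an injective, arc-preserving map
  on vertices.\<close>

lemma not_is_free_iff:
  assumes H: "pair_wf_digraph H" and G: "pair_wf_digraph G"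
  shows "\<not> is_free H G \<longleftrightarrow> (\<exists>f. inj_on f (pverts H) \<and> f ` pverts H \<subseteq> pverts G \<and>
    (\<forall>u v. (u, v) \<in> parcs H \<longrightarrow> (f u, f v) \<in> parcs G))"
    (is "_ \<longleftrightarrow> (\<exists>f. ?emb f)")
proof
  assume "\<not> is_free H G"
  then obtain h where sub: "subgraph (app_iso h (with_proj H)) (with_proj G)"
    and h: "pre_digraph.digraph_isomorphism (with_proj H) h"
    by (auto simp: is_free_def digraph_iso_def)
  \<comment> \<open>A subgraph inherits the tail and head functions of \<open>G\<close>, which are
    the two projections.\<close>
  have tail: "iso_tail h = fst" and head: "iso_head h = snd"
    using sub by (auto simp: subgraph_def compatible_def)
  have "(iso_verts h u, iso_verts h v) \<in> parcs G" if "(u, v) \<in> parcs H" for u v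
  proof -
    have "fst (iso_arcs h (u, v)) = iso_verts h u" "snd (iso_arcs h (u, v)) = iso_verts h v"
      using h that by (force simp: pre_digraph.digraph_isomorphism_def tail head)+
    then have "iso_arcs h (u, v) = (iso_verts h u, iso_verts h v)" by (simp add: prod_eq_iff)
    then show ?thesis using sub that by (force simp: subgraph_def)
  qed
  then show "\<exists>f. ?emb f"
    using h sub by (intro exI[of _ "iso_verts h"])
      (auto simp: subgraph_def pre_digraph.digraph_isomorphism_def)
next
  assume "\<exists>f. ?emb f"
  then obtain f where f: "?emb f" ..
  \<comment> \<open>The arc map is the one induced by \<open>f\<close>; the projections make the
    image compatible with \<open>G\<close>.\<close>
  define h where "h = \<lparr>iso_verts = f, iso_arcs = map_prod f f, iso_head = snd, iso_tail = fst\<rparr>"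
  interpret H: pair_wf_digraph H by (fact H)
  have "inj_on (map_prod f f) (parcs H)"
    using f by (intro inj_on_subset[OF map_prod_inj_on[of f "pverts H" f "pverts H"]])
      (auto dest: H.in_arcsD1 H.in_arcsD2)
  then have h: "H.digraph_isomorphism h"
    using f by (auto simp: H.digraph_isomorphism_def h_def intro: H.wf_digraph)
  have "subgraph (app_iso h (with_proj H)) (with_proj G)"
    using f G H.wf_digraphI_app_iso[OF h]
    by (auto simp: subgraph_def compatible_def h_def wf_digraph_wp_iff)
  then show "\<not> is_free H G" using h by (auto simp: is_free_def digraph_iso_def)
qed

text \<open>Double counting: the fibre over each unordered pair consists of the two distinct pairs
  \<open>(u, v)\<close> and \<open>(v, u)\<close>.\<close>

lemma card_sym_irrefl:
  assumes "finite R" and "sym R" and "irrefl R"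
  shows "card R = 2 * card ((\<lambda>(u, v). {u, v}) ` R)"
proof -
  let ?f = "\<lambda>(u, v). {u, v}"
  have fib: "card {x \<in> R. ?f x = e} = 2" if e: "e \<in> ?f ` R" for e
  proof -
    from e obtain u v where uv: "(u, v) \<in> R" "e = {u, v}" by auto
    have "u \<noteq> v" and vu: "(v, u) \<in> R"
      using uv(1) assms(2,3) by (auto simp: irrefl_def dest: symD)
    have "x \<in> R \<and> ?f x = e \<longleftrightarrow> x = (u, v) \<or> x = (v, u)" for x
      using uv(1) vu by (cases x) (auto simp: uv(2) doubleton_eq_iff)
    then have "{x \<in> R. ?f x = e} = {(u, v), (v, u)}" by (intro set_eqI) simp
    then show ?thesis using \<open>u \<noteq> v\<close> by simp
  qed
  have "card R = (\<Sum>e\<in>?f ` R. card {x \<in> R. ?f x = e})"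
    using sum.image_gen[OF assms(1), of "\<lambda>_. 1::nat" ?f] by simp
  then show ?thesis by (simp add: fib)
qed

lemma card_parcs_pair_graph:
  assumes "pair_graph G"
  shows "card (parcs G) = 2 * card (edges G)"
proof -
  interpret pair_graph G by (fact assms)
  show ?thesis
    unfolding edges_def
  proof (rule card_sym_irrefl[OF pair_finite_arcs])
    show "sym (parcs G)" by (rule symI) (rule arcs_symmetric)
    show "irrefl (parcs G)" using no_loops' by (simp add: irrefl_def) metis
  qed
qed

lemma card_edges_le_ex_graph:
  fixes G :: "nat pair_pre_digraph"
  assumes "pair_graph G" and "is_free H G"
  shows "card (edges G) \<le> ex_graph (card (pverts G)) H"
  unfolding ex_graph_def
proof (rule Max_ge)
  let ?n = "card (pverts G)"
  \<comment> \<open>A crude bound, enough to make the set of edge counts finite so that its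
    \<open>Max\<close> is an upper bound.\<close>
  have "card (edges G') \<le> ?n * ?n"
    if "pair_graph G'" "card (pverts G') = ?n" for G' :: "nat pair_pre_digraph"
  proof -
    interpret pair_graph G' by (fact that(1))
    have "card (edges G') \<le> card (parcs G')"
      unfolding edges_def using pair_finite_arcs by (rule card_image_le)
    also have "\<dots> \<le> card (pverts G' \<times> pverts G')"
      using pair_finite_verts by (intro card_mono) (auto dest: in_arcsD1 in_arcsD2)
    finally show ?thesis using that(2) by (simp add: card_cartesian_product)
  qed
  then show "finite {card (edges G') |G' :: nat pair_pre_digraph.
      pair_graph G' \<and> card (pverts G') = ?n \<and> is_free H G'}"
    by (intro finite_subset[OF _ finite_atMost[of "?n * ?n"]]) auto
qed (use assms in auto)

text \<open>The maximum is a genuine element of its set: \<open>m\<close> bounds the set, and the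
  arcless digraph is free of any \<open>H\<close> with an arc, so the set is nonempty.\<close>

lemma ex_digraph_le:
  assumes "pair_wf_digraph H" and "parcs H \<noteq> {}"
    and "\<And>G :: nat pair_pre_digraph.
      pair_digraph G \<Longrightarrow> card (pverts G) = n \<Longrightarrow> is_free H G \<Longrightarrow> card (parcs G) \<le> m"
  shows "ex_digraph n H \<le> m"
proof -
  let ?S = "{card (parcs G) | G :: nat pair_pre_digraph.
    pair_digraph G \<and> card (pverts G) = n \<and> is_free H G}"
  define E :: "nat pair_pre_digraph" where "E = \<lparr>pverts = {..<n}, parcs = {}\<rparr>"
  have E: "pair_digraph E" by unfold_locales (auto simp: E_def)
  then have "is_free H E"
    using not_is_free_iff[OF assms(1) pair_digraph.pair_wf_digraph[OF E]] assms(2)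
    by (auto simp: E_def)
  then have "?S \<noteq> {}" using E by (auto simp: E_def intro!: exI[of _ E])
  moreover have "?S \<subseteq> {..m}" using assms(3) by auto
  ultimately have "Max ?S \<in> {..m}" by (meson Max_in finite_subset finite_atMost subsetD)
  then show ?thesis by (simp add: ex_digraph_def)
qed

lemma pair_wf_digraph_complete_graph: "pair_wf_digraph (complete_graph k)"
  and pair_wf_digraph_path_graph: "pair_wf_digraph (path_graph k)"
  and pair_wf_digraph_directed_path: "pair_wf_digraph (directed_path k)"
  by (unfold_locales; auto simp: complete_graph_def path_graph_def directed_path_def)+

lemma not_is_free_directed_pathI:
  assumes "pair_wf_digraph G" and "distinct xs" and "set xs \<subseteq> pverts G"
    and "successively (\<lambda>u v. (u, v) \<in> parcs G) xs"
  shows "\<not> is_free (directed_path (length xs)) G"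
  unfolding not_is_free_iff[OF pair_wf_digraph_directed_path assms(1)]
  using assms(2-4)
  \<comment> \<open>Vertex \<open>i\<close> of the path goes to the \<open>i\<close>-th entry of the
    list.\<close>
  by (intro exI[of _ "(!) xs"])
    (auto simp: directed_path_def inj_on_nth successively_conv_nth)

theorem corollary1p1:
  fixes k n :: nat
  assumes "k \<ge> 1" and "n \<ge> 1"
  shows "ex_digraph n (directed_path (k + 1))
    \<le> ex_graph n (complete_graph (k + 1)) + ex_graph n (path_graph (k + 1))"
proof (rule ex_digraph_le)
  show "pair_wf_digraph (directed_path (k + 1))" by (fact pair_wf_digraph_directed_path)
  \<comment> \<open>For \<open>k = 0\<close> the path would be a single vertex without arcs;
    \<open>k \<ge> 1\<close> excludes this.\<close>
  have "(0, 1) \<in> parcs (directed_path (k + 1))" using assms(1) by (simp add: directed_path_def)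
  then show "parcs (directed_path (k + 1)) \<noteq> {}" by blast
next
  fix D :: "nat pair_pre_digraph"
  assume D: "pair_digraph D" and n: "card (pverts D) = n" and free: "is_free (directed_path (k + 1)) D"
  interpret D: pair_digraph D by (fact D)
  define G1 where "G1 = \<lparr>pverts = pverts D, parcs = parcs D \<union> (parcs D)\<inverse>\<rparr>"
  define G2 where "G2 = \<lparr>pverts = pverts D, parcs = parcs D \<inter> (parcs D)\<inverse>\<rparr>"
  have G1: "pair_graph G1"
    by unfold_locales (auto simp: G1_def symmetric_def sym_def D.pair_finite_verts
      D.pair_finite_arcs dest: D.in_arcsD1 D.in_arcsD2 D.no_loops')
  have G2: "pair_graph G2"
    by unfold_locales (auto simp: G2_def symmetric_def sym_def D.pair_finite_verts
      D.pair_finite_arcs dest: D.in_arcsD1 D.in_arcsD2 D.no_loops')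
  note wf = pair_digraph.pair_wf_digraph[OF pair_graph.axioms(1)]

  have "is_free (complete_graph (k + 1)) G1"
  proof (rule ccontr)
    assume "\<not> ?thesis"
    then obtain f where inj: "inj_on f {..<k + 1}" and verts: "f ` {..<k + 1} \<subseteq> pverts D"
      and adj: "\<And>u v. u < k + 1 \<Longrightarrow> v < k + 1 \<Longrightarrow> u \<noteq> v \<Longrightarrow>
        (f u, f v) \<in> parcs D \<or> (f v, f u) \<in> parcs D"
      unfolding not_is_free_iff[OF pair_wf_digraph_complete_graph wf[OF G1]]
      by (auto simp: complete_graph_def G1_def)
    have "\<exists>xs. set xs = f ` {..<k + 1} \<and> distinct xs \<and> successively (\<lambda>u v. (u, v) \<in> parcs D) xs"
      by (rule redei_Hamiltonian_path) (use adj in auto)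
    then obtain xs where xs: "set xs = f ` {..<k + 1}" "distinct xs"
      "successively (\<lambda>u v. (u, v) \<in> parcs D) xs" by blast
    \<comment> \<open>Injectivity of \<open>f\<close> gives the Hamiltonian path exactly
      \<open>k + 1\<close> vertices, the number forbidden in \<open>D\<close>.\<close>
    have "length xs = k + 1"
      using distinct_card[OF xs(2)] card_image[OF inj] by (simp add: xs(1))
    then show False
      using not_is_free_directed_pathI[OF D.pair_wf_digraph xs(2) _ xs(3)] xs(1) verts free by simp
  qed
  then have le1: "card (edges G1) \<le> ex_graph n (complete_graph (k + 1))"
    using card_edges_le_ex_graph[OF G1] n by (simp add: G1_def)

  have "is_free (path_graph (k + 1)) G2"
  proof (rule ccontr)
    assume "\<not> ?thesis"
    \<comment> \<open>The same embedding serves: arcs of the directed path are arcs of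
      \<open>path_graph\<close>, and arcs of \<open>G2\<close> are arcs of \<open>D\<close>.\<close>
    then have "\<not> is_free (directed_path (k + 1)) D"
      unfolding not_is_free_iff[OF pair_wf_digraph_path_graph wf[OF G2]]
        not_is_free_iff[OF pair_wf_digraph_directed_path D.pair_wf_digraph]
      by (auto simp: path_graph_def directed_path_def G2_def)
    then show False using free by contradiction
  qed
  then have le2: "card (edges G2) \<le> ex_graph n (path_graph (k + 1))"
    using card_edges_le_ex_graph[OF G2] n by (simp add: G2_def)

  \<comment> \<open>Inclusion-exclusion for the arcs and their reversals, two sets of equal size.
    The total is twice the arc count of \<open>D\<close>, and this factor cancels against the two
    arcs per edge in \<open>G1\<close> and \<open>G2\<close>.\<close>
  have "card (parcs G1) + card (parcs G2) = card (parcs D) + card ((parcs D)\<inverse>)"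
    using card_Un_Int[of "parcs D" "(parcs D)\<inverse>"] D.pair_finite_arcs by (simp add: G1_def G2_def)
  then have "card (parcs D) = card (edges G1) + card (edges G2)"
    by (simp add: card_parcs_pair_graph[OF G1] card_parcs_pair_graph[OF G2])
  then show "card (parcs D) \<le> ex_graph n (complete_graph (k + 1)) + ex_graph n (path_graph (k + 1))"
    using le1 le2 by simp
qed

end
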